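(* Under the standing assumptions in the context, let $$\boldsymbol\gamma_N=\frac1N\sum_{i=1}^N\delta_{X_i}\otimes\nu_i^{X_i}\in\operatorname{argmin}\mathcal J_{\Omega,N}.$$ Then $(\nu_i^{X_i})_{i=1}^N$ is a Nash equilibrium for the open-loop $N$-player game in mixed strategies.
   Context: Standing assumptions: $\mathcal X,\mathcal Y$ are Polish spaces; $\mu\in\mathscr P(\mathcal X)$ (Borel probability measures) is atomless; $c:\mathcal X\times\mathcal Y\to[0,+\infty]$, $L:\mathcal Y\to[0,+\infty]$, $H:\mathcal Y\times\mathcal Y\to[0,+\infty]$ are lower semi-continuous; $H$ is symmetric; $\{L\le\kappa\}$ is compact for every $\kappa>0$. $(\Omega,\mathcal F,\mathbb P)$ is a probability space carrying an i.i.d. sequence $(X_i)_{i\in\mathbb N}$ of $\mathcal X$-valued random variables with law $\mu$; $N$ is a positive integer. Notation: $\mathcal L(\nu)=\int L\,d\nu$, $\mathcal H(\nu,\bar\nu)=\int H\,d\nu\otimes\bar\nu$. A family $(\nu^x)_{x\in\mathcal X}\subset\mathscr P(\mathcal Y)$ is measurable if $x\mapsto\nu^x(B)$ is Borel for every Borel $B\subset\mathcal Y$. A random probability measure on a Polish space is a measurable map from $\Omega$ to its space of probability measures (with the Borel $\sigma$-algebra of the narrow topology). Open-loop game: the strategy of player $i\in\{1,\dots,N\}$ is $\boldsymbol\nu_i=\nu_i^{X_i}$ for a measurable family $(\nu_i^x)_{x\in\mathcal X}\subset\mathscr P(\mathcal Y)$, and player $i$ minimizes $$\mathcal J_{\Omega,i}(\boldsymbol\nu_i,\boldsymbol\nu_{-i})=\mathbb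 E\Big[\int_{\mathcal Y}c(X_i,y)\,d\nu_i^{X_i}(y)+\mathcal L(\nu_i^{X_i})+\frac2N\sum_{j\ne i}\mathcal H(\nu_i^{X_i},\nu_j^{X_j})\Big].$$ A profile is a Nash equilibrium if $\mathcal J_{\Omega,i}(\boldsymbol\nu_i,\boldsymbol\nu_{-i})\le\mathcal J_{\Omega,i}(\bar{\boldsymbol\nu}_i,\boldsymbol\nu_{-i})$ for all $i$ and all admissible $\bar{\boldsymbol\nu}_i$. $\mathscr P_{\Omega,N}(\mathcal X\times\mathcal Y)$ is the set of random measures $\boldsymbol\gamma_N=\frac1N\sum_{i=1}^N\delta_{X_i}\otimes\nu_i^{X_i}$ with each $(\nu_i^x)_{x\in\mathcal X}$ measurable. On random probability measures on $\mathcal X\times\mathcal Y$ define $$\mathcal J_{\Omega,N}(\boldsymbol\gamma_N)=\mathbb E\Big[\int c\,d\boldsymbol\gamma_N+\frac1N\sum_{i=1}^N\mathcal L(\nu_i^{X_i})+\frac1{N^2}\sum_{i\ne j}\mathcal H(\nu_i^{X_i},\nu_j^{X_j})\Big]$$ if $\boldsymbol\gamma_N\in\mathscr P_{\Omega,N}(\mathcal X\times\mathcal Y)$, and $+\infty$ otherwise.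
   Formalization: The argmin is taken to consist of minimizers with finite value; if the functional is identically +∞, every profile would be a minimizer and the claim fails (three players, two actions, c=L=0, H=∞ on the diagonal and 0 off it). *)

theory Defs
  imports "HOL-Probability.Probability"
begin

definition lower_semicontinuous :: "('a::topological_space \<Rightarrow> ennreal) \<Rightarrow> bool" where
  "lower_semicontinuous f \<longleftrightarrow> (\<forall>x. \<forall>a<f x. eventually (\<lambda>y. a < f y) (nhds x))"

definition atomless :: "'a measure \<Rightarrow> bool" where
  "atomless \<mu> \<longleftrightarrow>
    (\<forall>A\<in>sets \<mu>. 0 < emeasure \<mu> A \<longrightarrow>
      (\<exists>B\<in>sets \<mu>. B \<subseteq> A \<and> 0 < emeasure \<mu> B \<and> emeasure \<mu> B < emeasure \<mu> A))"

definition borel_probs :: "'a::topological_space measure set" where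
  "borel_probs = {\<nu>. prob_space \<nu> \<and> sets \<nu> = sets borel}"

text \<open>The narrow topology is the coarsest topology on the Borel probability measures that makes
  integration of every bounded continuous real function continuous.\<close>

definition narrow_topology :: "'a::topological_space measure topology" where
  "narrow_topology = topology_generated_by
    {{\<nu> \<in> borel_probs. (\<integral>z. f z \<partial>\<nu>) \<in> U} | (f :: 'a \<Rightarrow> real) U.
       continuous_on UNIV f \<and> bounded (range f) \<and> open U}"

definition narrow_borel :: "'a::topological_space measure measure" where
  "narrow_borel = sigma borel_probs {U. openin narrow_topology U}"

definition random_measures :: "'w measure \<Rightarrow> ('w \<Rightarrow> 'z::topological_space measure) set" where
  "random_measures M = M \<rightarrow>\<^sub>M narrow_borel"

definition measurable_family ::
    "('x::topological_space \<Rightarrow> 'y::topological_space measure) \<Rightarrow> bool" where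
  "measurable_family \<nu> \<longleftrightarrow>
    (\<forall>x. \<nu> x \<in> borel_probs) \<and> (\<forall>B\<in>sets borel. (\<lambda>x. emeasure (\<nu> x) B) \<in> borel_measurable borel)"

definition integral_L :: "('y \<Rightarrow> ennreal) \<Rightarrow> 'y measure \<Rightarrow> ennreal" where
  "integral_L L \<nu> = (\<integral>\<^sup>+ y. L y \<partial>\<nu>)"

definition integral_H :: "('y \<times> 'y \<Rightarrow> ennreal) \<Rightarrow> 'y measure \<Rightarrow> 'y measure \<Rightarrow> ennreal" where
  "integral_H H \<nu> \<nu>' = (\<integral>\<^sup>+ p. H p \<partial>(\<nu> \<Otimes>\<^sub>M \<nu>'))"


text \<open>Players are indexed by \<open>{..<N}\<close>. A strategy of player \<open>i\<close> is a random measure on the action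
  space, and a profile assigns one to every player.\<close>

definition admissible_strategy ::
    "'w measure \<Rightarrow> (nat \<Rightarrow> 'w \<Rightarrow> 'x::topological_space) \<Rightarrow> nat
      \<Rightarrow> ('w \<Rightarrow> 'y::topological_space measure) \<Rightarrow> bool" where
  "admissible_strategy M X i s \<longleftrightarrow>
    (\<exists>\<nu>. measurable_family \<nu> \<and> (\<forall>\<omega>\<in>space M. s \<omega> = \<nu> (X i \<omega>)))"

definition player_cost ::
    "'w measure \<Rightarrow> (nat \<Rightarrow> 'w \<Rightarrow> 'x) \<Rightarrow> nat \<Rightarrow> ('x \<times> 'y \<Rightarrow> ennreal) \<Rightarrow> ('y \<Rightarrow> ennreal)
      \<Rightarrow> ('y \<times> 'y \<Rightarrow> ennreal) \<Rightarrow> nat \<Rightarrow> (nat \<Rightarrow> 'w \<Rightarrow> 'y measure) \<Rightarrow> ennreal" where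
  "player_cost M X N c L H i s =
    (\<integral>\<^sup>+ \<omega>. (\<integral>\<^sup>+ y. c (X i \<omega>, y) \<partial>(s i \<omega>)) + integral_L L (s i \<omega>)
        + 2 / of_nat N * (\<Sum>j\<in>{..<N} - {i}. integral_H H (s i \<omega>) (s j \<omega>)) \<partial>M)"

definition nash_equilibrium ::
    "'w measure \<Rightarrow> (nat \<Rightarrow> 'w \<Rightarrow> 'x::topological_space) \<Rightarrow> nat
      \<Rightarrow> ('x \<times> 'y::topological_space \<Rightarrow> ennreal) \<Rightarrow> ('y \<Rightarrow> ennreal)
      \<Rightarrow> ('y \<times> 'y \<Rightarrow> ennreal) \<Rightarrow> (nat \<Rightarrow> 'w \<Rightarrow> 'y measure) \<Rightarrow> bool" where
  "nash_equilibrium M X N c L H s \<longleftrightarrow>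
    (\<forall>i<N. admissible_strategy M X i (s i)) \<and>
    (\<forall>i<N. \<forall>s'. admissible_strategy M X i s' \<longrightarrow>
       player_cost M X N c L H i s \<le> player_cost M X N c L H i (s(i := s')))"


definition empirical_measure ::
    "(nat \<Rightarrow> 'w \<Rightarrow> 'x::topological_space) \<Rightarrow> nat
      \<Rightarrow> (nat \<Rightarrow> 'x \<Rightarrow> 'y::topological_space measure) \<Rightarrow> 'w \<Rightarrow> ('x \<times> 'y) measure" where
  "empirical_measure X N \<nu> \<omega> = measure_of UNIV (sets borel)
    (\<lambda>A. (\<Sum>i<N. emeasure (return borel (X i \<omega>) \<Otimes>\<^sub>M \<nu> i (X i \<omega>)) A) / of_nat N)"

definition represents ::
    "'w measure \<Rightarrow> (nat \<Rightarrow> 'w \<Rightarrow> 'x::topological_space) \<Rightarrow> nat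
      \<Rightarrow> (nat \<Rightarrow> 'x \<Rightarrow> 'y::topological_space measure) \<Rightarrow> ('w \<Rightarrow> ('x \<times> 'y) measure) \<Rightarrow> bool" where
  "represents M X N \<nu> \<gamma> \<longleftrightarrow>
    (\<forall>i<N. measurable_family (\<nu> i)) \<and> (\<forall>\<omega>\<in>space M. \<gamma> \<omega> = empirical_measure X N \<nu> \<omega>)"

definition empirical_random_measures ::
    "'w measure \<Rightarrow> (nat \<Rightarrow> 'w \<Rightarrow> 'x::topological_space) \<Rightarrow> nat
      \<Rightarrow> ('w \<Rightarrow> ('x \<times> 'y::topological_space) measure) set" where
  "empirical_random_measures M X N = {\<gamma> \<in> random_measures M. \<exists>\<nu>. represents M X N \<nu> \<gamma>}"

text \<open>The functional depends on \<open>\<gamma>\<close> only: if the law of the i.i.d. variables \<open>X i\<close> is atomless, they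
  are almost surely pairwise distinct, so any two families representing \<open>\<gamma>\<close> agree almost surely
  along \<open>X\<close>. The choice of the representing family below is therefore immaterial.\<close>

definition social_cost ::
    "'w measure \<Rightarrow> (nat \<Rightarrow> 'w \<Rightarrow> 'x::topological_space) \<Rightarrow> nat
      \<Rightarrow> ('x \<times> 'y::topological_space \<Rightarrow> ennreal) \<Rightarrow> ('y \<Rightarrow> ennreal)
      \<Rightarrow> ('y \<times> 'y \<Rightarrow> ennreal) \<Rightarrow> ('w \<Rightarrow> ('x \<times> 'y) measure) \<Rightarrow> ennreal" where
  "social_cost M X N c L H \<gamma> =
    (if \<gamma> \<in> empirical_random_measures M X N then
       let \<nu> = (SOME \<nu>. represents M X N \<nu> \<gamma>) in
         (\<integral>\<^sup>+ \<omega>. (\<integral>\<^sup>+ p. c p \<partial>(\<gamma> \<omega>))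
            + 1 / of_nat N * (\<Sum>i<N. integral_L L (\<nu> i (X i \<omega>)))
            + 1 / (of_nat N)\<^sup>2 *
                (\<Sum>i<N. \<Sum>j\<in>{..<N} - {i}. integral_H H (\<nu> i (X i \<omega>)) (\<nu> j (X j \<omega>))) \<partial>M)
     else \<infinity>)"

text \<open>As usual for extended-real-valued functionals (Rockafellar--Wets, Variational Analysis), the
  argmin of a functional that is identically \<open>\<infinity>\<close> is empty. This matters for the game: take
  \<open>c = L = 0\<close>, actions \<open>a\<close> and \<open>b\<close> with \<open>H (a, a) = H (b, b) = \<infinity>\<close> and
  \<open>H (a, b) = H (b, a) = 0\<close>, and three players. Every profile has infinite social cost, but the
  profile where all play \<open>a\<close> is not an equilibrium.\<close>

definition argmin_on :: "'a set \<Rightarrow> ('a \<Rightarrow> ennreal) \<Rightarrow> 'a set" where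
  "argmin_on S F = {x \<in> S. F x < \<infinity> \<and> (\<forall>y\<in>S. F x \<le> F y)}"

end

theory Submission
  imports Defs
begin

text \<open>
The open-loop game has the social cost as its potential. In the interaction term each pair of players
is counted twice and \<open>H\<close> is symmetric, so for every player \<open>i\<close> the social cost is the sum of
\<open>1 / N\<close> times the cost of player \<open>i\<close> and of a remainder that does not depend on the strategy of
player \<open>i\<close> (\<open>profile_cost_decomposition\<close>). If \<open>i\<close> deviates, the new profile again defines an
empirical random measure. Minimality compares the two social costs, and the remainder is finite
because the minimum is, so it cancels: what is left is the equilibrium inequality.

Two points need an argument. Firstly, the social cost is a functional of the random measure and not
of the profile that represents it. The types are independent with an atomless law, hence almost
surely distinct (\<open>AE_sample_distinct\<close>), and then the empirical measure determines the strategy of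
each player by its mass over the type of that player (\<open>empirical_measure_determines_family\<close>); so
all representing profiles have the same cost (\<open>social_cost_empirical_measure\<close>).

Secondly, the empirical measure of the deviating profile has to be a measurable map into the space of
probability measures with the Borel sets of the narrow topology. Measurability of its evaluations on
open sets is immediate, but the narrow topology has uncountably many generators. It is contained in
the topology generated by the countably many conditions \<open>q < \<nu> G\<close>, where \<open>q\<close> is rational and
\<open>G\<close> is a finite union of sets in a countable base: integrals of bounded continuous functions
are approximated uniformly by finite sums of masses of superlevel sets, and the mass of an open set
is approximated from below by those of such \<open>G\<close>. Hence measurable evaluations suffice
(\<open>measurable_narrow_borelI\<close>).
\<close>

section \<open>Random measures and the narrow topology\<close>

text \<open>Only finitely many subbase members meet in a basic open set, so a countable subbase yields a
  countable base; arbitrary unions of basic sets are then countable unions, which a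
  \<open>\<sigma>\<close>-algebra absorbs.\<close>

lemma vimage_open_countable_subbase:
  assumes C: "countable C"
    and meas: "\<And>c. c \<in> C \<Longrightarrow> f -` c \<inter> space M \<in> sets M"
    and U: "openin (topology_generated_by C) U"
  shows "f -` U \<inter> space M \<in> sets M"
proof -
  from U have "(arbitrary union_of finite' intersection_of (\<lambda>x. x \<in> C)) U"
    by (simp only: openin_topology_generated_by_iff generate_topology_on_eq[symmetric])
  then obtain \<U> where \<U>: "\<Union>\<U> = U"
    and sub: "\<And>V. V \<in> \<U> \<Longrightarrow> (finite' intersection_of (\<lambda>x. x \<in> C)) V"
    unfolding union_of_def by blast
  have fin: "\<exists>F. finite F \<and> F \<noteq> {} \<and> F \<subseteq> C \<and> \<Inter>F = V" if "V \<in> \<U>" for V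
    using sub[OF that] unfolding intersection_of_def by auto
  have "\<U> \<subseteq> \<Inter> ` {F. finite F \<and> F \<subseteq> C}"
    using fin by blast
  then have "countable \<U>"
    by (rule countable_subset) (intro countable_image countable_Collect_finite_subset C)
  moreover have "f -` V \<inter> space M \<in> sets M" if "V \<in> \<U>" for V
  proof -
    obtain F where F: "finite F" "F \<noteq> {}" "F \<subseteq> C" "\<Inter>F = V"
      using fin[OF \<open>V \<in> \<U>\<close>] by blast
    have "f -` V \<inter> space M = (\<Inter>c\<in>F. f -` c \<inter> space M)"
      using F by blast
    also have "\<dots> \<in> sets M"
      using F meas by (intro sets.finite_INT) auto
    finally show ?thesis .
  qed
  moreover have "f -` U \<inter> space M = (\<Union>V\<in>\<U>. f -` V \<inter> space M)"
    using \<U> by blast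
  ultimately show ?thesis
    by (simp only:) (rule sets.countable_UN'; auto)
qed

text \<open>For a countable base \<open>B\<close> this family is countable, and by the lemmas below the topology that it
  generates contains the narrow topology. Finite unions of basic sets are needed because the mass
  of an open set is the supremum of the masses of such unions, but not of single basic sets.\<close>

definition narrow_subbase :: "'a::topological_space set set \<Rightarrow> 'a measure set set" where
  "narrow_subbase B =
    (\<lambda>(F, q). {\<nu> \<in> borel_probs. real_of_rat q < measure \<nu> (\<Union>F)}) ` ({F. finite F \<and> F \<subseteq> B} \<times> UNIV)"

lemma countable_narrow_subbase: "countable B \<Longrightarrow> countable (narrow_subbase B)"
  unfolding narrow_subbase_def
  by (intro countable_image countable_SIGMA countable_Collect_finite_subset) auto

lemma narrow_subbase_open:
  assumes "finite F" "F \<subseteq> B"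
  shows "openin (topology_generated_by (narrow_subbase B))
    {\<nu> \<in> borel_probs. r < measure \<nu> (\<Union>F)}"
proof -
  have "{\<nu> \<in> borel_probs. r < measure \<nu> (\<Union>F)} =
    (\<Union>q\<in>{q. r < real_of_rat q}. {\<nu> \<in> borel_probs. real_of_rat q < measure \<nu> (\<Union>F)})"
  proof (intro set_eqI iffI)
    fix \<nu> assume \<nu>: "\<nu> \<in> {\<nu> \<in> borel_probs. r < measure \<nu> (\<Union>F)}"
    then obtain q where "r < real_of_rat q" "real_of_rat q < measure \<nu> (\<Union>F)"
      using of_rat_dense by blast
    with \<nu> show "\<nu> \<in> (\<Union>q\<in>{q. r < real_of_rat q}.
        {\<nu> \<in> borel_probs. real_of_rat q < measure \<nu> (\<Union>F)})" by auto
  qed auto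
  also have "openin (topology_generated_by (narrow_subbase B)) \<dots>"
    unfolding narrow_subbase_def using assms
    by (intro openin_Union ballI) (auto intro!: topology_generated_by_Basis)
  finally show ?thesis .
qed

lemma borel_probsD:
  assumes "\<nu> \<in> borel_probs"
  shows "prob_space \<nu>" "sets \<nu> = sets borel" "space \<nu> = UNIV"
  using assms sets_eq_imp_space_eq[of \<nu> borel] by (auto simp: borel_probs_def)

text \<open>Continuity from below: an open set is the increasing union of finite unions of basic sets, so
  its mass exceeds \<open>r\<close> exactly if the mass of one of these unions does.\<close>

lemma openin_measure_open_greater:
  assumes B: "countable B" "topological_basis B" and U: "open U"
  shows "openin (topology_generated_by (narrow_subbase B))
    {\<nu> \<in> borel_probs. r < measure \<nu> U}"
proof -
  obtain B' where B': "B' \<subseteq> B" "\<Union>B' = U"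
    using B(2) U unfolding topological_basis by metis
  have "\<exists>F. finite F \<and> F \<subseteq> B' \<and> r < measure \<nu> (\<Union>F)"
    if \<nu>: "\<nu> \<in> borel_probs" and r: "r < measure \<nu> U" for \<nu>
  proof (cases "B' = {}")
    case True
    then show ?thesis using r B' by auto
  next
    case False
    interpret prob_space \<nu> using borel_probsD[OF \<nu>] by simp
    define G where "G n = \<Union>(from_nat_into B' ` {..n})" for n :: nat
    have "countable B'" using B(1) B'(1) countable_subset by blast
    then have range: "range (from_nat_into B') = B'"
      using False by (simp add: range_from_nat_into)
    have "(\<Union>n. G n) = \<Union>(range (from_nat_into B'))"
      unfolding G_def by auto
    then have GU: "(\<Union>n. G n) = U"
      unfolding range by (simp add: B')
    have opn: "open b" if "b \<in> B'" for b
      using that B'(1) topological_basis_open[OF B(2)] by auto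
    have "open (G n)" for n
      unfolding G_def using opn range by (intro open_Union) auto
    then have "range G \<subseteq> sets \<nu>"
      using borel_probsD(2)[OF \<nu>] by auto
    moreover have "incseq G"
      unfolding G_def incseq_def by (auto intro: order_trans)
    ultimately have "(\<lambda>n. measure \<nu> (G n)) \<longlonglongrightarrow> measure \<nu> U"
      using finite_Lim_measure_incseq[of G] GU by simp
    then have "eventually (\<lambda>n. r < measure \<nu> (G n)) sequentially"
      using r by (rule order_tendstoD)
    then obtain n where "r < measure \<nu> (G n)"
      by (auto simp: eventually_sequentially)
    moreover have "from_nat_into B' ` {..n} \<subseteq> B'"
      using range by auto
    ultimately show ?thesis
      unfolding G_def by blast
  qed
  moreover have "r < measure \<nu> U"
    if "\<nu> \<in> borel_probs" "F \<subseteq> B'" "r < measure \<nu> (\<Union>F)" for \<nu> F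
  proof -
    interpret prob_space \<nu> using borel_probsD[OF that(1)] by simp
    have "measure \<nu> (\<Union>F) \<le> measure \<nu> U"
      using that B' U borel_probsD(2)[OF that(1)] by (intro finite_measure_mono) auto
    with that show ?thesis by simp
  qed
  ultimately have "{\<nu> \<in> borel_probs. r < measure \<nu> U} =
    (\<Union>F\<in>{F. finite F \<and> F \<subseteq> B'}. {\<nu> \<in> borel_probs. r < measure \<nu> (\<Union>F)})"
    by (intro set_eqI iffI; simp; metis)
  also have "openin (topology_generated_by (narrow_subbase B)) \<dots>"
    using B'(1) by (intro openin_Union) (auto intro!: narrow_subbase_open)
  finally show ?thesis .
qed

text \<open>A sum exceeds \<open>r\<close> exactly if its terms exceed thresholds with sum \<open>r\<close>; superlevel sets of sums
  of lower semicontinuous functions are thus unions of finite intersections of open sets.\<close>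

lemma openin_sum_greater:
  fixes g :: "'i \<Rightarrow> 'a \<Rightarrow> real"
  assumes "finite I" and P: "openin T P"
    and "\<And>i r. i \<in> I \<Longrightarrow> openin T {x \<in> P. r < g i x}"
  shows "openin T {x \<in> P. r < (\<Sum>i\<in>I. g i x)}"
  using assms(1,3)
proof (induction I arbitrary: r)
  case empty
  then show ?case using P by (cases "r < 0") auto
next
  case (insert i I)
  have "{x \<in> P. r < (\<Sum>i\<in>insert i I. g i x)} =
    (\<Union>s. {x \<in> P. s < g i x} \<inter> {x \<in> P. r - s < (\<Sum>i\<in>I. g i x)})" (is "?L = ?R")
  proof
    show "?L \<subseteq> ?R"
    proof
      fix x assume x: "x \<in> ?L"
      then have "r - (\<Sum>i\<in>I. g i x) < g i x"
        using insert.hyps by auto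
      then obtain s where "r - (\<Sum>i\<in>I. g i x) < s" "s < g i x"
        using dense by blast
      then have "x \<in> {x \<in> P. s < g i x} \<inter> {x \<in> P. r - s < (\<Sum>i\<in>I. g i x)}"
        using x by auto
      then show "x \<in> ?R" by blast
    qed
    show "?R \<subseteq> ?L" using insert.hyps by auto
  qed
  also have "openin T \<dots>"
    using insert by (intro openin_Union) auto
  finally show ?case .
qed

lemma layer_count_bounds:
  fixes t :: real
  assumes "0 \<le> t" "t \<le> n"
  shows "t - 1 \<le> card {k\<in>{1..n}. real k < t}" "card {k\<in>{1..n}. real k < t} \<le> t"
proof -
  have eq: "{k\<in>{1..n}. real k < t} = {1..<nat \<lceil>t\<rceil>}"
  proof (intro set_eqI)
    fix k :: nat
    have "real k < t \<longleftrightarrow> k < nat \<lceil>t\<rceil>"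
      by (simp add: less_ceiling_iff zless_nat_eq_int_zless)
    then show "k \<in> {k\<in>{1..n}. real k < t} \<longleftrightarrow> k \<in> {1..<nat \<lceil>t\<rceil>}"
      using assms by auto
  qed
  show "t - 1 \<le> card {k\<in>{1..n}. real k < t}" "card {k\<in>{1..n}. real k < t} \<le> t"
    unfolding eq card_atLeastLessThan using assms by linarith+
qed

text \<open>A function with values in the unit interval differs by at most \<open>1 / n\<close> from the average of the
  indicators of its superlevel sets at the heights \<open>k / n\<close>. This controls its integral by the
  masses of finitely many open sets, uniformly in the measure.\<close>

lemma integral_layer_bounds:
  fixes f :: "'a::topological_space \<Rightarrow> real"
  assumes \<nu>: "\<nu> \<in> borel_probs" and f: "continuous_on UNIV f"
    and f01: "\<And>x. 0 \<le> f x" "\<And>x. f x \<le> 1" and n: "(n :: nat) > 0"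
  shows "(\<Sum>k=1..n. measure \<nu> {x. real k / real n < f x}) / real n \<le> (\<integral>x. f x \<partial>\<nu>)"
    and "(\<integral>x. f x \<partial>\<nu>) \<le> (\<Sum>k=1..n. measure \<nu> {x. real k / real n < f x}) / real n + 1 / real n"
proof -
  interpret prob_space \<nu> using borel_probsD[OF \<nu>] by simp
  have sets: "{x. r < f x} \<in> sets \<nu>" for r
    using open_Collect_less[OF continuous_on_const f] borel_probsD(2)[OF \<nu>] by auto
  have fm: "f \<in> borel_measurable \<nu>"
    using borel_measurable_continuous_onI[OF f] borel_probsD(2)[OF \<nu>]
    by (simp cong: measurable_cong_sets)
  have fi: "integrable \<nu> f"
    using fm f01 by (intro integrable_const_bound[where B=1]) auto
  define s where "s x = (\<Sum>k=1..n. indicator {x. real k / real n < f x} x) / real n" for x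
  have si: "integrable \<nu> s"
    unfolding s_def using sets by (intro integrable_divide integrable_sum) (auto simp: emeasure_eq_measure)
  have s_int: "(\<integral>x. s x \<partial>\<nu>) = (\<Sum>k=1..n. measure \<nu> {x. real k / real n < f x}) / real n"
    unfolding s_def using sets borel_probsD(3)[OF \<nu>]
    by (subst integral_divide_zero, subst Bochner_Integration.integral_sum)
      (auto simp: emeasure_eq_measure)
  have card: "s x = card {k\<in>{1..n}. real k < real n * f x} / n" for x
  proof -
    have "(\<Sum>k=1..n. indicator {x. real k / real n < f x} x :: real) = (\<Sum>k=1..n. if real k < real n * f x then 1 else 0)"
      using n by (intro sum.cong) (auto simp: indicator_def field_simps)
    also have "\<dots> = card {k\<in>{1..n}. real k < real n * f x}"
      by (simp add: sum.If_cases Int_def)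
    finally show ?thesis unfolding s_def by simp
  qed
  have b: "n * f x - 1 \<le> card {k\<in>{1..n}. real k < real n * f x}"
      "card {k\<in>{1..n}. real k < real n * f x} \<le> n * f x" for x
    using layer_count_bounds[of "n * f x" n] f01[of x] n by (auto simp: mult_left_le)
  have "s x \<le> f x" for x
    unfolding card using b(2)[of x] n by (simp add: field_simps)
  then show "(\<Sum>k=1..n. measure \<nu> {x. real k / real n < f x}) / real n \<le> (\<integral>x. f x \<partial>\<nu>)"
    unfolding s_int[symmetric] by (intro integral_mono si fi)
  have "f x \<le> s x + 1 / real n" for x
    unfolding card using b(1)[of x] n by (simp add: field_simps)
  then have "(\<integral>x. f x \<partial>\<nu>) \<le> (\<integral>x. s x + 1 / n \<partial>\<nu>)"
    using si fi by (intro integral_mono) auto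
  also have "\<dots> = (\<integral>x. s x \<partial>\<nu>) + 1 / real n"
    using si by (simp add: prob_space)
  finally show "(\<integral>x. f x \<partial>\<nu>) \<le> (\<Sum>k=1..n. measure \<nu> {x. real k / real n < f x}) / real n + 1 / real n"
    unfolding s_int .
qed

lemma openin_borel_probs:
  assumes "countable B" "topological_basis B"
  shows "openin (topology_generated_by (narrow_subbase B)) borel_probs"
  using openin_measure_open_greater[OF assms, of "{}" "-1"] by simp

text \<open>The layer sums underestimate the integral by at most \<open>1 / n\<close>, so an integral exceeds \<open>a\<close> exactly
  if one of its layer sums does; the latter is an open condition because the layers are open.\<close>

lemma openin_integral_unit_greater:
  fixes f :: "'a::topological_space \<Rightarrow> real"
  assumes B: "countable B" "topological_basis B" and f: "continuous_on UNIV f"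
    and f01: "\<And>x. 0 \<le> f x" "\<And>x. f x \<le> 1"
  shows "openin (topology_generated_by (narrow_subbase B)) {\<nu> \<in> borel_probs. a < (\<integral>x. f x \<partial>\<nu>)}"
proof -
  let ?S = "\<lambda>(n::nat) \<nu>. (\<Sum>k=1..n. measure \<nu> {x. real k / real n < f x})"
  have "{\<nu> \<in> borel_probs. a < (\<integral>x. f x \<partial>\<nu>)} =
      (\<Union>n\<in>{0<..}. {\<nu> \<in> borel_probs. real n * a < ?S n \<nu>})" (is "?L = ?R")
  proof
    show "?L \<subseteq> ?R"
    proof
      fix \<nu> assume \<nu>: "\<nu> \<in> ?L"
      then obtain m where m: "inverse (Suc m) < (\<integral>x. f x \<partial>\<nu>) - a"
        using reals_Archimedean[of "(\<integral>x. f x \<partial>\<nu>) - a"] by auto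
      have "a < ?S (Suc m) \<nu> / Suc m"
        using m integral_layer_bounds(2)[OF _ f f01, of \<nu> "Suc m"] \<nu> by (auto simp: inverse_eq_divide)
      then have "Suc m * a < ?S (Suc m) \<nu>"
        by (simp add: field_simps)
      then show "\<nu> \<in> ?R" using \<nu> by (intro UN_I[of "Suc m"]) auto
    qed
    show "?R \<subseteq> ?L"
    proof
      fix \<nu> assume "\<nu> \<in> ?R"
      then obtain n where n: "n > 0" "real n * a < ?S n \<nu>" "\<nu> \<in> borel_probs" by auto
      then have "a < ?S n \<nu> / n" by (simp add: field_simps)
      also have "\<dots> \<le> (\<integral>x. f x \<partial>\<nu>)"
        using integral_layer_bounds(1)[OF _ f f01] n by blast
      finally show "\<nu> \<in> ?L" using n by blast
    qed
  qed
  also have "openin (topology_generated_by (narrow_subbase B)) ?R"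
  proof (intro openin_Union, safe)
    fix n :: nat assume "n > 0"
    show "openin (topology_generated_by (narrow_subbase B)) {\<nu> \<in> borel_probs. real n * a < ?S n \<nu>}"
      by (intro openin_sum_greater openin_borel_probs openin_measure_open_greater B
          open_Collect_less continuous_on_const f) auto
  qed
  finally show ?thesis .
qed

lemma openin_integral_greater:
  fixes f :: "'a::topological_space \<Rightarrow> real"
  assumes B: "countable B" "topological_basis B" and f: "continuous_on UNIV f"
    and bnd: "bounded (range f)"
  shows "openin (topology_generated_by (narrow_subbase B)) {\<nu> \<in> borel_probs. a < (\<integral>x. f x \<partial>\<nu>)}"
proof -
  obtain K where K: "K > 0" "\<And>x. \<bar>f x\<bar> \<le> K"
    using bnd by (auto simp: bounded_pos)
  \<comment> \<open>rescaling into the unit interval commutes with the integral because all measures have mass one\<close>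
  define g where "g x = (f x + K) / (2 * K)" for x
  have g01: "0 \<le> g x" "g x \<le> 1" for x
    using K(1) K(2)[of x] by (auto simp: g_def field_simps)
  have g: "continuous_on UNIV g"
    unfolding g_def using K by (intro continuous_intros f) auto
  have "(\<integral>x. g x \<partial>\<nu>) = ((\<integral>x. f x \<partial>\<nu>) + K) / (2 * K)" if \<nu>: "\<nu> \<in> borel_probs" for \<nu>
  proof -
    interpret prob_space \<nu> using borel_probsD[OF \<nu>] by simp
    have "f \<in> borel_measurable \<nu>"
      using borel_measurable_continuous_onI[OF f] borel_probsD(2)[OF \<nu>]
      by (simp cong: measurable_cong_sets)
    then have "integrable \<nu> f"
      using K by (intro integrable_const_bound[where B=K]) auto
    then show ?thesis
      unfolding g_def by (simp add: prob_space)
  qed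
  then have "{\<nu> \<in> borel_probs. a < (\<integral>x. f x \<partial>\<nu>)} =
      {\<nu> \<in> borel_probs. (a + K) / (2 * K) < (\<integral>x. g x \<partial>\<nu>)}"
    using K(1) by (auto simp: field_simps)
  then show ?thesis
    using openin_integral_unit_greater[OF B g g01] by simp
qed

text \<open>Applying the bound from below to \<open>f\<close> and to \<open>- f\<close> confines the integral to an open interval.\<close>

lemma openin_integral_vimage:
  fixes f :: "'a::topological_space \<Rightarrow> real"
  assumes B: "countable B" "topological_basis B" and f: "continuous_on UNIV f"
    and bnd: "bounded (range f)" and U: "open U"
  shows "openin (topology_generated_by (narrow_subbase B)) {\<nu> \<in> borel_probs. (\<integral>x. f x \<partial>\<nu>) \<in> U}"
proof -
  let ?T = "topology_generated_by (narrow_subbase B)"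
  have "{\<nu> \<in> borel_probs. (\<integral>x. f x \<partial>\<nu>) \<in> U} =
    (\<Union>(a, b)\<in>{(a, b). {a<..<b} \<subseteq> U}.
      {\<nu> \<in> borel_probs. a < (\<integral>x. f x \<partial>\<nu>)} \<inter> {\<nu> \<in> borel_probs. - b < (\<integral>x. - f x \<partial>\<nu>)})" (is "?L = ?R")
  proof
    show "?L \<subseteq> ?R"
    proof
      fix \<nu> assume \<nu>: "\<nu> \<in> ?L"
      then obtain e where "e > 0" and e: "ball (\<integral>x. f x \<partial>\<nu>) e \<subseteq> U"
        using U openE by blast
      have "{(\<integral>x. f x \<partial>\<nu>) - e <..< (\<integral>x. f x \<partial>\<nu>) + e} \<subseteq> U"
        using e by (simp add: ball_eq_greaterThanLessThan)
      then show "\<nu> \<in> ?R"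
        using \<nu> \<open>e > 0\<close>
        by (intro UN_I[of "((\<integral>x. f x \<partial>\<nu>) - e, (\<integral>x. f x \<partial>\<nu>) + e)"]) auto
    qed
    show "?R \<subseteq> ?L" by (auto simp: subset_eq)
  qed
  also have "openin ?T ?R"
  proof (intro openin_Union, safe)
    fix a b
    have "bounded (range (\<lambda>x. - f x))"
      using bnd by (simp add: bounded_iff)
    then show "openin ?T ({\<nu> \<in> borel_probs. a < (\<integral>x. f x \<partial>\<nu>)} \<inter>
        {\<nu> \<in> borel_probs. - b < (\<integral>x. - f x \<partial>\<nu>)})"
      by (intro openin_Int openin_integral_greater B f bnd continuous_on_minus)
  qed
  finally show ?thesis .
qed

lemma openin_narrow_imp_openin_subbase:
  fixes B :: "'a::topological_space set set"
  assumes B: "countable B" "topological_basis B" and U: "openin narrow_topology U"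
  shows "openin (topology_generated_by (narrow_subbase B)) U"
  using U unfolding narrow_topology_def openin_topology_generated_by_iff
  by (rule generate_topology_on_coarsest[OF istopology_generate_topology_on, rotated])
    (use openin_integral_vimage[OF B] in \<open>auto simp: openin_topology_generated_by_iff\<close>)

lemma openin_narrow_subset_borel_probs:
  assumes "openin narrow_topology U" shows "U \<subseteq> borel_probs"
  using openin_subset[OF assms] unfolding narrow_topology_def topology_generated_by_topspace by auto

text \<open>A random measure is usually given by the measurability of its evaluations on sets, whereas the
  Borel structure of the narrow topology involves all of its open sets, that is, arbitrary unions.
  Second countability of the underlying space makes the two descriptions agree.\<close>

theorem measurable_narrow_borelI:
  fixes K :: "'w \<Rightarrow> 'a::second_countable_topology measure"
  assumes K: "\<And>\<omega>. \<omega> \<in> space M \<Longrightarrow> K \<omega> \<in> borel_probs"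
    and eval: "\<And>A. open A \<Longrightarrow> (\<lambda>\<omega>. emeasure (K \<omega>) A) \<in> borel_measurable M"
  shows "K \<in> M \<rightarrow>\<^sub>M narrow_borel"
  unfolding narrow_borel_def
proof (rule measurable_measure_of)
  show "{U. openin narrow_topology U} \<subseteq> Pow (borel_probs :: 'a measure set)"
    using openin_narrow_subset_borel_probs by blast
  show "K \<in> space M \<rightarrow> borel_probs" using K by blast
  fix U :: "'a measure set" assume "U \<in> {U. openin narrow_topology U}"
  then have U: "openin narrow_topology U" by simp
  obtain B :: "'a set set" where B: "countable B" "topological_basis B"
    using ex_countable_basis by blast
  show "K -` U \<inter> space M \<in> sets M"
  proof (rule vimage_open_countable_subbase)
    show "countable (narrow_subbase B)" by (rule countable_narrow_subbase[OF B(1)])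
    show "openin (topology_generated_by (narrow_subbase B)) U"
      by (rule openin_narrow_imp_openin_subbase[OF B U])
    fix c assume "c \<in> narrow_subbase B"
    then obtain F q where c: "c = {\<nu> \<in> borel_probs. real_of_rat q < measure \<nu> (\<Union>F)}"
      and F: "F \<subseteq> B"
      unfolding narrow_subbase_def by auto
    have "open (\<Union>F)" using F topological_basis_open[OF B(2)] by auto
    from eval[OF this] have [measurable]: "(\<lambda>\<omega>. measure (K \<omega>) (\<Union>F)) \<in> borel_measurable M"
      unfolding measure_def by measurable
    have "K -` c \<inter> space M = {\<omega> \<in> space M. real_of_rat q < measure (K \<omega>) (\<Union>F)}"
      using K unfolding c by auto
    also have "\<dots> \<in> sets M" by measurable
    finally show "K -` c \<inter> space M \<in> sets M" .
  qed
qed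

section \<open>Measurable families and the measurability of the costs\<close>

lemma lower_semicontinuous_borel_measurable:
  assumes "lower_semicontinuous f" shows "f \<in> borel_measurable borel"
proof (rule borel_measurableI_greater)
  fix a
  have "open {x. a < f x}"
    using assms unfolding lower_semicontinuous_def
    by (subst open_subopen) (auto simp: eventually_nhds subset_eq)
  then show "{x \<in> space borel. a < f x} \<in> sets borel" by simp
qed

lemma measurable_family_kernel:
  assumes "measurable_family \<nu>" shows "\<nu> \<in> borel \<rightarrow>\<^sub>M prob_algebra borel"
  using assms unfolding measurable_family_def
  by (intro measurable_prob_algebraI measurable_subprob_algebra)
    (auto simp: borel_probs_def prob_space_imp_subprob_space)

lemma borel_probs_eq_space_prob_algebra: "borel_probs = space (prob_algebra borel)"
  by (auto simp: borel_probs_def space_prob_algebra)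

lemma measurable_integral_against_kernel:
  fixes c :: "'x::second_countable_topology \<times> 'y::second_countable_topology \<Rightarrow> ennreal"
  assumes c: "c \<in> borel_measurable borel" and [measurable]: "X \<in> borel_measurable M"
    and \<kappa>: "\<kappa> \<in> M \<rightarrow>\<^sub>M prob_algebra borel"
  shows "(\<lambda>\<omega>. \<integral>\<^sup>+ y. c (X \<omega>, y) \<partial>\<kappa> \<omega>) \<in> borel_measurable M"
proof -
  have [measurable]: "c \<in> borel_measurable (borel \<Otimes>\<^sub>M borel)"
    using c by (simp add: borel_prod)
  show ?thesis
    by (rule nn_integral_measurable_subprob_algebra2[OF _ measurable_prob_algebraD[OF \<kappa>]]) measurable
qed

lemma measurable_integral_L:
  assumes L: "L \<in> borel_measurable borel" and \<kappa>: "\<kappa> \<in> M \<rightarrow>\<^sub>M prob_algebra borel"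
  shows "(\<lambda>\<omega>. integral_L L (\<kappa> \<omega>)) \<in> borel_measurable M"
  unfolding integral_L_def
  by (rule nn_integral_measurable_subprob_algebra2[OF _ measurable_prob_algebraD[OF \<kappa>]])
    (use L in measurable)

lemma integral_H_iterated:
  fixes H :: "'y::second_countable_topology \<times> 'y \<Rightarrow> ennreal"
  assumes H: "H \<in> borel_measurable borel" and \<nu>: "\<nu> \<in> borel_probs" and \<nu>': "\<nu>' \<in> borel_probs"
  shows "integral_H H \<nu> \<nu>' = (\<integral>\<^sup>+ y. \<integral>\<^sup>+ y'. H (y, y') \<partial>\<nu>' \<partial>\<nu>)"
proof -
  interpret prob_space \<nu>' using borel_probsD[OF \<nu>'] by simp
  have [measurable_cong]: "sets \<nu> = sets borel" "sets \<nu>' = sets borel"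
    using borel_probsD \<nu> \<nu>' by auto
  have [measurable]: "H \<in> borel_measurable (borel \<Otimes>\<^sub>M borel)"
    using H by (simp add: borel_prod)
  show ?thesis unfolding integral_H_def
    by (rule nn_integral_fst[symmetric]) measurable
qed

text \<open>Tonelli's theorem turns the symmetry of the interaction kernel into symmetry of the interaction
  of two mixed strategies.\<close>

lemma integral_H_commute:
  fixes H :: "'y::second_countable_topology \<times> 'y \<Rightarrow> ennreal"
  assumes H: "H \<in> borel_measurable borel" and sym: "\<And>y y'. H (y, y') = H (y', y)"
    and \<nu>: "\<nu> \<in> borel_probs" and \<nu>': "\<nu>' \<in> borel_probs"
  shows "integral_H H \<nu> \<nu>' = integral_H H \<nu>' \<nu>"
proof -
  interpret P: prob_space \<nu> using borel_probsD[OF \<nu>] by simp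
  interpret Q: prob_space \<nu>' using borel_probsD[OF \<nu>'] by simp
  interpret pair_sigma_finite \<nu> \<nu>' ..
  have [measurable_cong]: "sets \<nu> = sets borel" "sets \<nu>' = sets borel"
    using borel_probsD \<nu> \<nu>' by auto
  have [measurable]: "H \<in> borel_measurable (borel \<Otimes>\<^sub>M borel)"
    using H by (simp add: borel_prod)
  have "(\<integral>\<^sup>+ y'. \<integral>\<^sup>+ y. H (y, y') \<partial>\<nu> \<partial>\<nu>') = (\<integral>\<^sup>+ y. \<integral>\<^sup>+ y'. H (y, y') \<partial>\<nu>' \<partial>\<nu>)"
    by (rule Fubini) measurable
  then show ?thesis
    unfolding integral_H_iterated[OF H \<nu> \<nu>'] integral_H_iterated[OF H \<nu>' \<nu>]
    by (simp add: sym)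
qed

lemma kernel_in_borel_probs:
  "\<kappa> \<in> M \<rightarrow>\<^sub>M prob_algebra borel \<Longrightarrow> \<omega> \<in> space M \<Longrightarrow> \<kappa> \<omega> \<in> borel_probs"
  unfolding borel_probs_eq_space_prob_algebra by (rule measurable_space)

lemma measurable_integral_H:
  fixes H :: "'y::second_countable_topology \<times> 'y \<Rightarrow> ennreal"
  assumes H: "H \<in> borel_measurable borel"
    and \<kappa>: "\<kappa> \<in> M \<rightarrow>\<^sub>M prob_algebra borel" and \<kappa>': "\<kappa>' \<in> M \<rightarrow>\<^sub>M prob_algebra borel"
  shows "(\<lambda>\<omega>. integral_H H (\<kappa> \<omega>) (\<kappa>' \<omega>)) \<in> borel_measurable M"
proof -
  have [measurable]: "H \<in> borel_measurable (borel \<Otimes>\<^sub>M borel)"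
    using H by (simp add: borel_prod)
  have inner: "(\<lambda>(\<omega>, y). \<integral>\<^sup>+ y'. H (y, y') \<partial>\<kappa>' \<omega>) \<in> borel_measurable (M \<Otimes>\<^sub>M borel)"
    unfolding case_prod_beta
    by (rule nn_integral_measurable_subprob_algebra2[where N=borel])
      (use measurable_prob_algebraD[OF \<kappa>'] in measurable)
  have "(\<lambda>\<omega>. \<integral>\<^sup>+ y. \<integral>\<^sup>+ y'. H (y, y') \<partial>\<kappa>' \<omega> \<partial>\<kappa> \<omega>) \<in> borel_measurable M"
    by (rule nn_integral_measurable_subprob_algebra2[OF inner measurable_prob_algebraD[OF \<kappa>]])
  then show ?thesis
    using integral_H_iterated[OF H kernel_in_borel_probs[OF \<kappa>] kernel_in_borel_probs[OF \<kappa>']]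
    by (simp cong: measurable_cong)
qed

section \<open>Empirical measures of a profile\<close>

lemma nn_integral_return_pair:
  assumes \<nu>: "\<nu> \<in> borel_probs" and f: "f \<in> borel_measurable (borel \<Otimes>\<^sub>M borel)"
  shows "(\<integral>\<^sup>+ p. f p \<partial>(return borel x \<Otimes>\<^sub>M \<nu>)) = (\<integral>\<^sup>+ y. f (x, y) \<partial>\<nu>)"
proof -
  interpret prob_space \<nu> using borel_probsD[OF \<nu>] by simp
  have [measurable_cong]: "sets \<nu> = sets borel" "sets (return borel x) = sets borel"
    using borel_probsD[OF \<nu>] by simp_all
  note f[measurable]
  have "(\<integral>\<^sup>+ p. f p \<partial>(return borel x \<Otimes>\<^sub>M \<nu>)) = (\<integral>\<^sup>+ x. \<integral>\<^sup>+ y. f (x, y) \<partial>\<nu> \<partial>return borel x)"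
    by (rule nn_integral_fst[symmetric]) measurable
  also have "\<dots> = (\<integral>\<^sup>+ y. f (x, y) \<partial>\<nu>)"
    by (rule nn_integral_return) measurable
  finally show ?thesis .
qed

text \<open>An empirical measure is the law of a two-stage experiment: draw a player uniformly, then draw
  from that player's component. The default beyond \<open>N\<close> is an arbitrary probability measure; it
  makes the second stage a Markov kernel on all of \<open>nat\<close>, and the uniform choice never reaches it.\<close>

definition sampled_kernel ::
    "(nat \<Rightarrow> 'w \<Rightarrow> 'x::second_countable_topology) \<Rightarrow> nat
      \<Rightarrow> (nat \<Rightarrow> 'x \<Rightarrow> 'y::second_countable_topology measure) \<Rightarrow> 'w \<Rightarrow> nat \<Rightarrow> ('x \<times> 'y) measure" where
  "sampled_kernel X N \<nu> \<omega> i =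
    (if i < N then return borel (X i \<omega>) \<Otimes>\<^sub>M \<nu> i (X i \<omega>) else return borel undefined)"

lemma sampled_kernel_in_prob_algebra:
  assumes "\<And>i. i < N \<Longrightarrow> \<nu> i (X i \<omega>) \<in> borel_probs"
  shows "sampled_kernel X N \<nu> \<omega> i \<in> space (prob_algebra borel)"
proof (cases "i < N")
  case True
  interpret Q: prob_space "\<nu> i (X i \<omega>)" using borel_probsD[OF assms[OF True]] by simp
  interpret R: prob_space "return borel (X i \<omega>)" by (rule prob_space_return) simp
  interpret K: pair_prob_space "return borel (X i \<omega>)" "\<nu> i (X i \<omega>)" ..
  have "sets (return borel (X i \<omega>) \<Otimes>\<^sub>M \<nu> i (X i \<omega>)) = sets borel"
    using borel_probsD(2)[OF assms[OF True]]
    by (simp add: borel_prod[symmetric] cong: sets_pair_measure_cong)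
  then show ?thesis
    using True K.P.prob_space_axioms by (simp add: space_prob_algebra sampled_kernel_def)
next
  case False
  then show ?thesis
    by (simp add: space_prob_algebra sampled_kernel_def prob_space_return)
qed

text \<open>The two-stage description shows at once that the set function in \<open>empirical_measure\<close> is countably
  additive with total mass one, and it supplies the formula for integrals below.\<close>

lemma empirical_measure_eq_bind:
  fixes X :: "nat \<Rightarrow> 'w \<Rightarrow> 'x::second_countable_topology"
    and \<nu> :: "nat \<Rightarrow> 'x \<Rightarrow> 'y::second_countable_topology measure"
  assumes N: "N > 0" and \<nu>: "\<And>i. i < N \<Longrightarrow> \<nu> i (X i \<omega>) \<in> borel_probs"
  shows "empirical_measure X N \<nu> \<omega> =
    measure_pmf (pmf_of_set {..<N}) \<bind> sampled_kernel X N \<nu> \<omega>" (is "_ = ?K")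
proof -
  let ?p = "measure_pmf (pmf_of_set {..<N})"
  have ker: "sampled_kernel X N \<nu> \<omega> \<in> ?p \<rightarrow>\<^sub>M prob_algebra borel"
    using sampled_kernel_in_prob_algebra[where X=X and \<nu>=\<nu>, OF \<nu>] by simp
  have p: "?p \<in> space (prob_algebra ?p)"
    by (simp add: space_prob_algebra measure_pmf.prob_space_axioms)
  have sets: "sets ?K = sets borel"
    by (rule sets_bind'[OF p ker])
  have space: "space ?K = UNIV"
    using sets_eq_imp_space_eq[OF sets] by simp
  have em: "emeasure ?K A = (\<Sum>i<N. emeasure (return borel (X i \<omega>) \<Otimes>\<^sub>M \<nu> i (X i \<omega>)) A) / of_nat N"
    if "A \<in> sets borel" for A
  proof -
    have "emeasure ?K A = (\<integral>\<^sup>+ i. emeasure (sampled_kernel X N \<nu> \<omega> i) A \<partial>?p)"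
      by (rule emeasure_bind_prob_algebra[OF p ker that])
    also have "\<dots> = (\<Sum>i<N. emeasure (sampled_kernel X N \<nu> \<omega> i) A) / of_nat N"
      using N by (subst nn_integral_pmf_of_set) auto
    finally show ?thesis by (simp add: sampled_kernel_def)
  qed
  have "empirical_measure X N \<nu> \<omega> = measure_of (space ?K) (sets ?K) (emeasure ?K)"
    unfolding empirical_measure_def sets space
    by (rule measure_of_eq) (auto simp: em sets.sigma_sets_eq[of borel, simplified])
  then show ?thesis by (simp add: measure_of_of_measure)
qed

lemma empirical_measure_in_borel_probs:
  fixes X :: "nat \<Rightarrow> 'w \<Rightarrow> 'x::second_countable_topology"
    and \<nu> :: "nat \<Rightarrow> 'x \<Rightarrow> 'y::second_countable_topology measure"
  assumes N: "N > 0" and \<nu>: "\<And>i. i < N \<Longrightarrow> \<nu> i (X i \<omega>) \<in> borel_probs"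
  shows "empirical_measure X N \<nu> \<omega> \<in> borel_probs"
proof -
  let ?p = "measure_pmf (pmf_of_set {..<N})"
  have ker: "sampled_kernel X N \<nu> \<omega> \<in> ?p \<rightarrow>\<^sub>M prob_algebra borel"
    using sampled_kernel_in_prob_algebra[where X=X and \<nu>=\<nu>, OF \<nu>] by simp
  have p: "?p \<in> space (prob_algebra ?p)"
    by (simp add: space_prob_algebra measure_pmf.prob_space_axioms)
  show ?thesis
    using prob_space_bind'[OF p ker] sets_bind'[OF p ker]
      empirical_measure_eq_bind[where X=X and \<nu>=\<nu> and \<omega>=\<omega>, OF assms]
    by (simp add: borel_probs_def)
qed

lemma nn_integral_empirical_measure:
  fixes X :: "nat \<Rightarrow> 'w \<Rightarrow> 'x::second_countable_topology"
    and \<nu> :: "nat \<Rightarrow> 'x \<Rightarrow> 'y::second_countable_topology measure"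
  assumes N: "N > 0" and \<nu>: "\<And>i. i < N \<Longrightarrow> \<nu> i (X i \<omega>) \<in> borel_probs"
    and f: "f \<in> borel_measurable borel"
  shows "(\<integral>\<^sup>+ p. f p \<partial>empirical_measure X N \<nu> \<omega>) =
    (\<Sum>i<N. \<integral>\<^sup>+ y. f (X i \<omega>, y) \<partial>\<nu> i (X i \<omega>)) / of_nat N"
proof -
  let ?p = "measure_pmf (pmf_of_set {..<N})"
  have ker: "sampled_kernel X N \<nu> \<omega> \<in> ?p \<rightarrow>\<^sub>M subprob_algebra borel"
    using sampled_kernel_in_prob_algebra[where X=X and \<nu>=\<nu>, OF \<nu>]
    by (intro measurable_prob_algebraD) simp
  have "(\<integral>\<^sup>+ p. f p \<partial>empirical_measure X N \<nu> \<omega>) = (\<integral>\<^sup>+ i. \<integral>\<^sup>+ p. f p \<partial>sampled_kernel X N \<nu> \<omega> i \<partial>?p)"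
    by (subst empirical_measure_eq_bind[where X=X and \<nu>=\<nu> and \<omega>=\<omega>, OF N \<nu>])
      (auto intro: nn_integral_bind[OF f ker])
  also have "\<dots> = (\<Sum>i<N. \<integral>\<^sup>+ p. f p \<partial>sampled_kernel X N \<nu> \<omega> i) / of_nat N"
    using N by (subst nn_integral_pmf_of_set) auto
  also have "(\<Sum>i<N. \<integral>\<^sup>+ p. f p \<partial>sampled_kernel X N \<nu> \<omega> i) =
      (\<Sum>i<N. \<integral>\<^sup>+ y. f (X i \<omega>, y) \<partial>\<nu> i (X i \<omega>))"
    using f by (intro sum.cong) (auto simp: sampled_kernel_def borel_prod nn_integral_return_pair[OF \<nu>])
  finally show ?thesis .
qed

text \<open>This makes every profile of measurable families, in particular one obtained by a unilateral
  deviation, a competitor in the minimization of the social cost.\<close>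

lemma empirical_measure_random_measure:
  fixes X :: "nat \<Rightarrow> 'w \<Rightarrow> 'x::second_countable_topology"
    and \<nu> :: "nat \<Rightarrow> 'x \<Rightarrow> 'y::second_countable_topology measure"
  assumes N: "N > 0" and X: "\<And>i. i < N \<Longrightarrow> X i \<in> borel_measurable M"
    and \<nu>: "\<And>i. i < N \<Longrightarrow> measurable_family (\<nu> i)"
  shows "empirical_measure X N \<nu> \<in> random_measures M"
  unfolding random_measures_def
proof (rule measurable_narrow_borelI)
  have probs: "\<nu> i (X i \<omega>) \<in> borel_probs" if "i < N" for i \<omega>
    using \<nu>[OF that] by (auto simp: measurable_family_def)
  show "empirical_measure X N \<nu> \<omega> \<in> borel_probs" for \<omega>
    by (rule empirical_measure_in_borel_probs[where X=X and \<nu>=\<nu>, OF N probs])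
  fix A :: "('x \<times> 'y) set" assume A: "open A"
  have "emeasure (empirical_measure X N \<nu> \<omega>) A =
    (\<Sum>i<N. \<integral>\<^sup>+ y. indicator A (X i \<omega>, y) \<partial>\<nu> i (X i \<omega>)) / of_nat N" for \<omega>
    using A nn_integral_empirical_measure[where X=X and \<nu>=\<nu>, OF N probs, of "indicator A" \<omega>]
      borel_probsD(2)[OF empirical_measure_in_borel_probs[where X=X and \<nu>=\<nu>, OF N probs, of \<omega>]]
    by simp
  moreover have "(\<lambda>\<omega>. \<integral>\<^sup>+ y. indicator A (X i \<omega>, y) \<partial>\<nu> i (X i \<omega>)) \<in> borel_measurable M"
    if "i < N" for i
    by (rule measurable_integral_against_kernel[OF _ X[OF that]
          measurable_compose[OF X[OF that] measurable_family_kernel[OF \<nu>[OF that]]]])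
      (use A in auto)
  ultimately show "(\<lambda>\<omega>. emeasure (empirical_measure X N \<nu> \<omega>) A) \<in> borel_measurable M"
    by simp
qed

text \<open>If the sampled types are pairwise distinct, the fibre over the type of player \<open>i\<close> carries the
  contribution of that player alone, so the strategy can be read off from the empirical measure.\<close>

lemma emeasure_empirical_measure_fibre:
  fixes X :: "nat \<Rightarrow> 'w \<Rightarrow> 'x::{second_countable_topology, t1_space}"
    and \<nu> :: "nat \<Rightarrow> 'x \<Rightarrow> 'y::second_countable_topology measure"
  assumes \<nu>: "\<And>i. i < N \<Longrightarrow> \<nu> i (X i \<omega>) \<in> borel_probs"
    and inj: "inj_on (\<lambda>i. X i \<omega>) {..<N}" and i: "i < N" and A: "A \<in> sets borel"
  shows "emeasure (empirical_measure X N \<nu> \<omega>) ({X i \<omega>} \<times> A) = emeasure (\<nu> i (X i \<omega>)) A / of_nat N"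
proof -
  from i have N: "N > 0" by simp
  note probs = empirical_measure_in_borel_probs[where X=X and \<nu>=\<nu>, OF N \<nu>]
  have S: "{X i \<omega>} \<times> A \<in> sets borel"
    unfolding borel_prod[symmetric] using A by auto
  have "emeasure (empirical_measure X N \<nu> \<omega>) ({X i \<omega>} \<times> A) =
      (\<Sum>j<N. \<integral>\<^sup>+ y. indicator ({X i \<omega>} \<times> A) (X j \<omega>, y) \<partial>\<nu> j (X j \<omega>)) / of_nat N"
    using nn_integral_empirical_measure[where X=X and \<nu>=\<nu> and f="indicator ({X i \<omega>} \<times> A)", OF N \<nu>]
      S borel_probsD(2)[OF probs] by simp
  also have "(\<Sum>j<N. \<integral>\<^sup>+ y. indicator ({X i \<omega>} \<times> A) (X j \<omega>, y) \<partial>\<nu> j (X j \<omega>)) =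
      (\<Sum>j<N. if j = i then emeasure (\<nu> i (X i \<omega>)) A else 0)"
  proof (intro sum.cong refl)
    fix j assume j: "j \<in> {..<N}"
    show "(\<integral>\<^sup>+ y. indicator ({X i \<omega>} \<times> A) (X j \<omega>, y) \<partial>\<nu> j (X j \<omega>)) =
      (if j = i then emeasure (\<nu> i (X i \<omega>)) A else 0)"
    proof (cases "j = i")
      case True
      have "(\<lambda>y. indicator ({X i \<omega>} \<times> A) (X i \<omega>, y)) = (indicator A :: 'y \<Rightarrow> ennreal)"
        by (auto simp: indicator_def)
      then show ?thesis
        using True A borel_probsD(2)[OF \<nu>[OF i]] by simp
    next
      case False
      then have "X j \<omega> \<noteq> X i \<omega>" using inj i j by (auto dest: inj_onD)
      then show ?thesis using False by simp
    qed
  qed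
  also have "\<dots> = emeasure (\<nu> i (X i \<omega>)) A"
    using i by simp
  finally show ?thesis .
qed

lemma empirical_measure_determines_family:
  fixes X :: "nat \<Rightarrow> 'w \<Rightarrow> 'x::{second_countable_topology, t1_space}"
    and \<nu> \<nu>' :: "nat \<Rightarrow> 'x \<Rightarrow> 'y::second_countable_topology measure"
  assumes \<nu>: "\<And>i. i < N \<Longrightarrow> \<nu> i (X i \<omega>) \<in> borel_probs"
    and \<nu>': "\<And>i. i < N \<Longrightarrow> \<nu>' i (X i \<omega>) \<in> borel_probs"
    and eq: "empirical_measure X N \<nu> \<omega> = empirical_measure X N \<nu>' \<omega>"
    and inj: "inj_on (\<lambda>i. X i \<omega>) {..<N}" and i: "i < N"
  shows "\<nu> i (X i \<omega>) = \<nu>' i (X i \<omega>)"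
proof (rule measure_eqI)
  show "sets (\<nu> i (X i \<omega>)) = sets (\<nu>' i (X i \<omega>))"
    using borel_probsD(2)[OF \<nu>[OF i]] borel_probsD(2)[OF \<nu>'[OF i]] by simp
  fix A assume "A \<in> sets (\<nu> i (X i \<omega>))"
  then have A: "A \<in> sets borel" using borel_probsD(2)[OF \<nu>[OF i]] by simp
  have "emeasure (\<nu> i (X i \<omega>)) A / of_nat N = emeasure (\<nu>' i (X i \<omega>)) A / of_nat N"
    using emeasure_empirical_measure_fibre[where X=X and \<nu>=\<nu>, OF \<nu> inj i A]
      emeasure_empirical_measure_fibre[where X=X and \<nu>=\<nu>', OF \<nu>' inj i A] eq by simp
  then show "emeasure (\<nu> i (X i \<omega>)) A = emeasure (\<nu>' i (X i \<omega>)) A"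
    using i by (simp add: divide_ennreal_def mult.commute[of _ "inverse (of_nat N)"]
        ennreal_mult_cancel_left)
qed

section \<open>Atomless samples are almost surely distinct\<close>

lemma atomless_singleton_null:
  fixes \<mu> :: "'x::t1_space measure"
  assumes \<mu>: "atomless \<mu>" and sets: "sets \<mu> = sets borel"
  shows "emeasure \<mu> {x} = 0"
proof (rule ccontr)
  assume "emeasure \<mu> {x} \<noteq> 0"
  moreover have "{x} \<in> sets \<mu>" using sets by simp
  ultimately obtain B where "B \<subseteq> {x}" "0 < emeasure \<mu> B" "emeasure \<mu> B < emeasure \<mu> {x}"
    using \<mu> unfolding atomless_def by (metis zero_less_iff_neq_zero)
  then show False by (auto simp: subset_singleton_iff)
qed

lemma (in prob_space) indep_vars_imp_indep_var:
  assumes ind: "indep_vars M' X I" and ij: "i \<in> I" "j \<in> I" "i \<noteq> j"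
  shows "indep_var (M' i) (X i) (M' j) (X j)"
proof -
  have "indep_var (PiM {i} M') (\<lambda>\<omega>. restrict (\<lambda>k. X k \<omega>) {i}) (PiM {j} M') (\<lambda>\<omega>. restrict (\<lambda>k. X k \<omega>) {j})"
    using ij by (intro indep_var_restrict[OF ind]) auto
  from indep_var_compose[OF this, of "\<lambda>f. f i" "M' i" "\<lambda>f. f j" "M' j"]
  show ?thesis by (simp add: comp_def)
qed

text \<open>The joint law is a product measure, and by Fubini the diagonal has mass zero because each of its
  sections is a single point.\<close>

lemma (in prob_space) AE_indep_var_neq:
  fixes U V :: "'a \<Rightarrow> 'x::{second_countable_topology, t2_space}"
  assumes ind: "indep_var borel U borel V"
    and null: "\<And>x. emeasure (distr M borel V) {x} = 0"
  shows "AE \<omega> in M. U \<omega> \<noteq> V \<omega>"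
proof -
  have [measurable]: "U \<in> borel_measurable M" "V \<in> borel_measurable M"
    and joint: "distr M borel U \<Otimes>\<^sub>M distr M borel V = distr M (borel \<Otimes>\<^sub>M borel) (\<lambda>\<omega>. (U \<omega>, V \<omega>))"
    using ind by (auto simp: indep_var_distribution_eq)
  interpret V: prob_space "distr M borel V" by (rule prob_space_distr) simp
  define D where "D = {p :: 'x \<times> 'x. fst p = snd p}"
  have D: "D \<in> sets (borel \<Otimes>\<^sub>M borel)"
    unfolding D_def borel_prod by (intro borel_closed closed_Collect_eq continuous_intros)
  have "emeasure M {\<omega> \<in> space M. U \<omega> = V \<omega>} = emeasure (distr M (borel \<Otimes>\<^sub>M borel) (\<lambda>\<omega>. (U \<omega>, V \<omega>))) D"
    using D by (subst emeasure_distr) (auto simp: D_def intro!: arg_cong[where f="emeasure M"])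
  also have "\<dots> = emeasure (distr M borel U \<Otimes>\<^sub>M distr M borel V) D"
    by (simp only: joint)
  also have "\<dots> = (\<integral>\<^sup>+ x. emeasure (distr M borel V) (Pair x -` D) \<partial>distr M borel U)"
    using D by (intro V.emeasure_pair_measure_alt) simp
  also have "\<dots> = 0"
  proof -
    have "Pair x -` D = {x}" for x by (auto simp: D_def)
    then show ?thesis by (simp add: null)
  qed
  finally have "emeasure M {\<omega> \<in> space M. \<not> U \<omega> \<noteq> V \<omega>} = 0" by simp
  moreover have "{\<omega> \<in> space M. \<not> U \<omega> \<noteq> V \<omega>} \<in> sets M"
  proof -
    have "{\<omega> \<in> space M. \<not> U \<omega> \<noteq> V \<omega>} = (\<lambda>\<omega>. (U \<omega>, V \<omega>)) -` D \<inter> space M"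
      by (auto simp: D_def)
    also have "\<dots> \<in> sets M" by (rule measurable_sets[OF _ D]) measurable
    finally show ?thesis .
  qed
  ultimately show ?thesis by (subst AE_iff_measurable) auto
qed

lemma (in prob_space) AE_sample_distinct:
  fixes X :: "nat \<Rightarrow> 'a \<Rightarrow> 'x::{second_countable_topology, t2_space}"
  assumes ind: "indep_vars (\<lambda>_. borel) X UNIV"
    and distr: "\<And>i. distr M borel (X i) = \<mu>"
    and null: "\<And>x. emeasure \<mu> {x} = 0"
  shows "AE \<omega> in M. inj (\<lambda>i. X i \<omega>)"
proof -
  have "AE \<omega> in M. i \<noteq> j \<longrightarrow> X i \<omega> \<noteq> X j \<omega>" for i j
    using AE_indep_var_neq[OF indep_vars_imp_indep_var[OF ind, of i j]] null distr
    by (cases "i = j") auto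
  then have "AE \<omega> in M. \<forall>i j. i \<noteq> j \<longrightarrow> X i \<omega> \<noteq> X j \<omega>"
    by (simp add: AE_all_countable)
  then show ?thesis
    by eventually_elim (auto simp: inj_on_def)
qed

section \<open>Decomposition of the social cost\<close>

text \<open>Each pair of distinct players occurs twice in the double sum. The pairs that involve \<open>i\<close>
  therefore contribute twice the interaction of \<open>i\<close> with the others: this is the source of the
  factor \<open>2\<close> in the cost of a player.\<close>

lemma symmetric_double_sum_remove:
  fixes h :: "'i \<Rightarrow> 'i \<Rightarrow> 'a::comm_semiring_1"
  assumes fin: "finite I" and i: "i \<in> I"
    and sym: "\<And>k l. k \<in> I \<Longrightarrow> l \<in> I \<Longrightarrow> h k l = h l k"
  shows "(\<Sum>k\<in>I. \<Sum>l\<in>I - {k}. h k l) =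
    2 * (\<Sum>j\<in>I - {i}. h i j) + (\<Sum>k\<in>I - {i}. \<Sum>l\<in>I - {i} - {k}. h k l)"
proof -
  have "(\<Sum>k\<in>I. \<Sum>l\<in>I - {k}. h k l) =
      (\<Sum>j\<in>I - {i}. h i j) + (\<Sum>k\<in>I - {i}. \<Sum>l\<in>I - {k}. h k l)"
    using fin i by (rule sum.remove)
  also have "(\<Sum>k\<in>I - {i}. \<Sum>l\<in>I - {k}. h k l) =
      (\<Sum>k\<in>I - {i}. h i k + (\<Sum>l\<in>I - {i} - {k}. h k l))"
  proof (intro sum.cong refl)
    fix k assume k: "k \<in> I - {i}"
    have "(\<Sum>l\<in>I - {k}. h k l) = h k i + (\<Sum>l\<in>I - {k} - {i}. h k l)"
      using fin i k by (intro sum.remove) auto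
    also have "I - {k} - {i} = I - {i} - {k}" by auto
    finally show "(\<Sum>l\<in>I - {k}. h k l) = h i k + (\<Sum>l\<in>I - {i} - {k}. h k l)"
      using sym[of k i] k i by simp
  qed
  finally show ?thesis
    by (simp add: sum.distrib mult_2 add.assoc)
qed

text \<open>The integral in the social cost, but evaluated at a given profile and not at one
  chosen among those that represent the random measure.\<close>

definition profile_cost ::
    "'w measure \<Rightarrow> (nat \<Rightarrow> 'w \<Rightarrow> 'x) \<Rightarrow> nat \<Rightarrow> ('x \<times> 'y \<Rightarrow> ennreal) \<Rightarrow> ('y \<Rightarrow> ennreal)
      \<Rightarrow> ('y \<times> 'y \<Rightarrow> ennreal) \<Rightarrow> (nat \<Rightarrow> 'w \<Rightarrow> 'y measure) \<Rightarrow> ennreal" where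
  "profile_cost M X N c L H s =
    (\<integral>\<^sup>+ \<omega>. (\<Sum>i<N. \<integral>\<^sup>+ y. c (X i \<omega>, y) \<partial>(s i \<omega>)) / of_nat N
        + 1 / of_nat N * (\<Sum>i<N. integral_L L (s i \<omega>))
        + 1 / (of_nat N)\<^sup>2 * (\<Sum>i<N. \<Sum>j\<in>{..<N} - {i}. integral_H H (s i \<omega>) (s j \<omega>)) \<partial>M)"

definition others_cost ::
    "'w measure \<Rightarrow> (nat \<Rightarrow> 'w \<Rightarrow> 'x) \<Rightarrow> nat \<Rightarrow> ('x \<times> 'y \<Rightarrow> ennreal) \<Rightarrow> ('y \<Rightarrow> ennreal)
      \<Rightarrow> ('y \<times> 'y \<Rightarrow> ennreal) \<Rightarrow> nat \<Rightarrow> (nat \<Rightarrow> 'w \<Rightarrow> 'y measure) \<Rightarrow> ennreal" where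
  "others_cost M X N c L H i s =
    (\<integral>\<^sup>+ \<omega>. 1 / of_nat N * (\<Sum>k\<in>{..<N} - {i}. \<integral>\<^sup>+ y. c (X k \<omega>, y) \<partial>(s k \<omega>))
        + 1 / of_nat N * (\<Sum>k\<in>{..<N} - {i}. integral_L L (s k \<omega>))
        + 1 / (of_nat N)\<^sup>2 *
            (\<Sum>k\<in>{..<N} - {i}. \<Sum>l\<in>{..<N} - {i} - {k}. integral_H H (s k \<omega>) (s l \<omega>)) \<partial>M)"

lemma others_cost_upd: "others_cost M X N c L H i (s(i := s')) = others_cost M X N c L H i s"
  unfolding others_cost_def by (intro nn_integral_cong) simp

text \<open>The social cost uses some family that represents the random measure, not necessarily \<open>\<nu>\<close>. Where
  the sampled types are distinct, the random measure determines all strategies along the sample,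
  so both families have the same costs almost surely.\<close>

lemma social_cost_empirical_measure:
  fixes X :: "nat \<Rightarrow> 'w \<Rightarrow> 'x::{second_countable_topology, t1_space}"
    and \<nu> :: "nat \<Rightarrow> 'x \<Rightarrow> 'y::second_countable_topology measure"
  assumes N: "N > 0" and X: "\<And>i. i < N \<Longrightarrow> X i \<in> borel_measurable M"
    and inj: "AE \<omega> in M. inj_on (\<lambda>i. X i \<omega>) {..<N}"
    and \<nu>: "\<And>i. i < N \<Longrightarrow> measurable_family (\<nu> i)"
    and c: "c \<in> borel_measurable borel"
  shows "social_cost M X N c L H (empirical_measure X N \<nu>) =
    profile_cost M X N c L H (\<lambda>i \<omega>. \<nu> i (X i \<omega>))"
proof -
  let ?\<gamma> = "empirical_measure X N \<nu>"
  define \<nu>' where "\<nu>' = (SOME \<nu>'. represents M X N \<nu>' ?\<gamma>)"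
  have rep: "represents M X N \<nu> ?\<gamma>" using \<nu> by (simp add: represents_def)
  then have rep': "represents M X N \<nu>' ?\<gamma>"
    unfolding \<nu>'_def by (rule someI[where P="\<lambda>\<nu>'. represents M X N \<nu>' ?\<gamma>"])
  have mem: "?\<gamma> \<in> empirical_random_measures M X N"
    using rep empirical_measure_random_measure[where X=X and \<nu>=\<nu>, OF N X \<nu>]
    by (auto simp: empirical_random_measures_def)
  have p: "\<nu> i (X i \<omega>) \<in> borel_probs" if "i < N" for i \<omega>
    using \<nu>[OF that] by (auto simp: measurable_family_def)
  have p': "\<nu>' i (X i \<omega>) \<in> borel_probs" if "i < N" for i \<omega>
    using rep' that by (auto simp: represents_def measurable_family_def)
  have "AE \<omega> in M. \<forall>i<N. \<nu>' i (X i \<omega>) = \<nu> i (X i \<omega>)"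
    using inj
  proof (rule AE_mp, intro AE_I2 impI allI)
    fix \<omega> i assume \<omega>: "\<omega> \<in> space M" "inj_on (\<lambda>i. X i \<omega>) {..<N}" and i: "i < N"
    have "empirical_measure X N \<nu>' \<omega> = ?\<gamma> \<omega>"
      using rep' \<omega>(1) by (simp add: represents_def)
    then show "\<nu>' i (X i \<omega>) = \<nu> i (X i \<omega>)"
      using \<omega>(2) i p p'
      by (intro empirical_measure_determines_family[where X=X and \<nu>=\<nu>' and \<nu>'=\<nu> and \<omega>=\<omega> and N=N])
  qed
  then show ?thesis
    unfolding social_cost_def profile_cost_def if_P[OF mem] Let_def \<nu>'_def[symmetric]
    by (intro nn_integral_cong_AE)
      (auto simp: nn_integral_empirical_measure[where X=X and \<nu>=\<nu>, OF N p c])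
qed

lemma ennreal_inverse_of_nat_power2: "1 / (of_nat N)\<^sup>2 = (1 / of_nat N) * (1 / of_nat N :: ennreal)"
  by (simp add: divide_ennreal_def power2_eq_square ennreal_inverse_mult ennreal_of_nat_eq_real_of_nat)

text \<open>The game is a potential game: a deviation of player \<open>i\<close> changes the social cost by \<open>1 / N\<close> times
  the change of that player's own cost. The identity is stated with sums, since in \<open>ennreal\<close>
  differences of possibly infinite costs would carry no information.\<close>

lemma profile_cost_decomposition:
  fixes X :: "nat \<Rightarrow> 'w \<Rightarrow> 'x::second_countable_topology"
    and c :: "'x \<times> 'y::second_countable_topology \<Rightarrow> ennreal"
  assumes X: "\<And>i. i < N \<Longrightarrow> X i \<in> borel_measurable M"
    and s: "\<And>i. i < N \<Longrightarrow> s i \<in> M \<rightarrow>\<^sub>M prob_algebra borel"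
    and c: "c \<in> borel_measurable borel" and L: "L \<in> borel_measurable borel"
    and H: "H \<in> borel_measurable borel" and sym: "\<And>y y'. H (y, y') = H (y', y)"
    and i: "i < N"
  shows "profile_cost M X N c L H s =
    1 / of_nat N * player_cost M X N c L H i s + others_cost M X N c L H i s"
proof -
  define u where "u = 1 / (of_nat N :: ennreal)"
  define C where "C k \<omega> = (\<integral>\<^sup>+ y. c (X k \<omega>, y) \<partial>(s k \<omega>))" for k \<omega>
  define \<Lambda> where "\<Lambda> k \<omega> = integral_L L (s k \<omega>)" for k \<omega>
  define h where "h \<omega> k l = integral_H H (s k \<omega>) (s l \<omega>)" for k l \<omega>
  have u2: "1 / (of_nat N)\<^sup>2 = u * u" "2 / of_nat N = 2 * u" 
    "(\<Sum>k<N. f k) / of_nat N = u * (\<Sum>k<N. f k)" for f :: "nat \<Rightarrow> ennreal"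
    unfolding u_def ennreal_inverse_of_nat_power2 by (simp_all add: divide_ennreal_def mult.commute)
  have Cm[measurable]: "C k \<in> borel_measurable M" if "k < N" for k
    unfolding C_def using c X[OF that] s[OF that] by (rule measurable_integral_against_kernel)
  have Lm[measurable]: "\<Lambda> k \<in> borel_measurable M" if "k < N" for k
    unfolding \<Lambda>_def using L s[OF that] by (rule measurable_integral_L)
  have hm[measurable]: "(\<lambda>\<omega>. h \<omega> k l) \<in> borel_measurable M" if "k < N" "l < N" for k l
    unfolding h_def using H s[OF that(1)] s[OF that(2)] by (rule measurable_integral_H)
  let ?P = "\<lambda>\<omega>. C i \<omega> + \<Lambda> i \<omega> + 2 * u * (\<Sum>j\<in>{..<N} - {i}. h \<omega> i j)"
  let ?R = "\<lambda>\<omega>. u * (\<Sum>k\<in>{..<N} - {i}. C k \<omega>) + u * (\<Sum>k\<in>{..<N} - {i}. \<Lambda> k \<omega>)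
      + u * u * (\<Sum>k\<in>{..<N} - {i}. \<Sum>l\<in>{..<N} - {i} - {k}. h \<omega> k l)"
  have Pm: "?P \<in> borel_measurable M" and Rm: "?R \<in> borel_measurable M"
    using i by (auto intro!: borel_measurable_add borel_measurable_times borel_measurable_sum Cm Lm hm)
  have "profile_cost M X N c L H s = (\<integral>\<^sup>+ \<omega>. u * ?P \<omega> + ?R \<omega> \<partial>M)"
    unfolding profile_cost_def C_def[symmetric] \<Lambda>_def[symmetric] h_def[symmetric] u2 u_def[symmetric]
  proof (rule nn_integral_cong)
    fix \<omega> assume \<omega>: "\<omega> \<in> space M"
    have "(\<Sum>k<N. \<Sum>l\<in>{..<N} - {k}. h \<omega> k l) = 2 * (\<Sum>j\<in>{..<N} - {i}. h \<omega> i j)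
        + (\<Sum>k\<in>{..<N} - {i}. \<Sum>l\<in>{..<N} - {i} - {k}. h \<omega> k l)"
      using i \<omega> unfolding h_def
      by (intro symmetric_double_sum_remove integral_H_commute[OF H sym] kernel_in_borel_probs[OF s]) auto
    moreover have "(\<Sum>k<N. C k \<omega>) = C i \<omega> + (\<Sum>k\<in>{..<N} - {i}. C k \<omega>)"
      "(\<Sum>k<N. \<Lambda> k \<omega>) = \<Lambda> i \<omega> + (\<Sum>k\<in>{..<N} - {i}. \<Lambda> k \<omega>)"
      using i by (simp_all add: sum.remove)
    ultimately show "u * (\<Sum>k<N. C k \<omega>) + u * (\<Sum>k<N. \<Lambda> k \<omega>)
        + u * u * (\<Sum>k<N. \<Sum>l\<in>{..<N} - {k}. h \<omega> k l) = u * ?P \<omega> + ?R \<omega>"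
      by (simp add: distrib_left ac_simps)
  qed
  also have "\<dots> = u * (\<integral>\<^sup>+ \<omega>. ?P \<omega> \<partial>M) + (\<integral>\<^sup>+ \<omega>. ?R \<omega> \<partial>M)"
    using Pm Rm by (subst nn_integral_add) (auto simp: nn_integral_cmult)
  finally show ?thesis
    unfolding player_cost_def others_cost_def C_def[symmetric] \<Lambda>_def[symmetric] h_def[symmetric]
      u2 u_def[symmetric] .
qed

section \<open>Minimizers of the social cost are equilibria\<close>

theorem proposition4p2:
  fixes M :: "'w measure"
    and \<mu> :: "'x::polish_space measure"
    and X :: "nat \<Rightarrow> 'w \<Rightarrow> 'x"
    and N :: nat
    and c :: "'x \<times> 'y::polish_space \<Rightarrow> ennreal"
    and L :: "'y \<Rightarrow> ennreal"
    and H :: "'y \<times> 'y \<Rightarrow> ennreal"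
    and \<nu> :: "nat \<Rightarrow> 'x \<Rightarrow> 'y measure"
  assumes "\<mu> \<in> borel_probs" and "atomless \<mu>"
    and "lower_semicontinuous c" and "lower_semicontinuous L" and "lower_semicontinuous H"
    and "\<And>y y'. H (y, y') = H (y', y)"
    and "\<And>\<kappa>::real. \<kappa> > 0 \<Longrightarrow> compact {y. L y \<le> ennreal \<kappa>}"
    and "prob_space M"
    and "prob_space.indep_vars M (\<lambda>_. borel) X UNIV"
    and "\<And>i. distr M borel (X i) = \<mu>"
    and "N > 0"
    and "\<And>i. i < N \<Longrightarrow> measurable_family (\<nu> i)"
    and "empirical_measure X N \<nu> \<in> argmin_on (random_measures M) (social_cost M X N c L H)"
  shows "nash_equilibrium M X N c L H (\<lambda>i \<omega>. \<nu> i (X i \<omega>))"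
proof -
  interpret prob_space M by fact
  note N = \<open>N > 0\<close> and fam = assms(12)
  have X: "X i \<in> borel_measurable M" for i
    using assms(9) by (auto simp: indep_vars_def)
  have c: "c \<in> borel_measurable borel" and L: "L \<in> borel_measurable borel"
    and H: "H \<in> borel_measurable borel"
    by (intro lower_semicontinuous_borel_measurable assms(3-5))+
  have "emeasure \<mu> {x} = 0" for x
    using atomless_singleton_null[OF assms(2)] borel_probsD(2)[OF assms(1)] .
  then have "AE \<omega> in M. inj (\<lambda>i. X i \<omega>)"
    by (rule AE_sample_distinct[OF assms(9,10)])
  then have inj: "AE \<omega> in M. inj_on (\<lambda>i. X i \<omega>) {..<N}"
    by eventually_elim (rule inj_on_subset, auto)
  let ?s = "\<lambda>i \<omega>. \<nu> i (X i \<omega>)"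
  note kernel = measurable_compose[OF X measurable_family_kernel]
  note social = social_cost_empirical_measure[where X=X, OF N X inj _ c]
  note split = profile_cost_decomposition[where X=X, OF X _ c L H assms(6)]
  have fin: "social_cost M X N c L H (empirical_measure X N \<nu>) < \<infinity>"
    and opt: "\<And>\<gamma>. \<gamma> \<in> random_measures M \<Longrightarrow>
      social_cost M X N c L H (empirical_measure X N \<nu>) \<le> social_cost M X N c L H \<gamma>"
    using assms(13) by (auto simp: argmin_on_def)
  show ?thesis
    unfolding nash_equilibrium_def
  proof (intro conjI allI impI)
    fix i assume i: "i < N"
    show "admissible_strategy M X i (?s i)"
      using fam[OF i] by (auto simp: admissible_strategy_def)
  next
    fix i s' assume i: "i < N" and "admissible_strategy M X i (s' :: 'w \<Rightarrow> 'y measure)"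
    then obtain \<eta> :: "'x \<Rightarrow> 'y measure" where \<eta>: "measurable_family \<eta>" "\<And>\<omega>. \<omega> \<in> space M \<Longrightarrow> s' \<omega> = \<eta> (X i \<omega>)"
      by (auto simp: admissible_strategy_def)
    define \<nu>' where "\<nu>' = \<nu>(i := \<eta>)"
    have fam': "measurable_family (\<nu>' j)" if "j < N" for j
      using fam[OF that] \<eta>(1) by (simp add: \<nu>'_def)
    let ?s' = "\<lambda>i \<omega>. \<nu>' i (X i \<omega>)"
    let ?R = "others_cost M X N c L H i ?s"
    have s': "?s' = ?s(i := ?s' i)"
      by (auto simp: \<nu>'_def fun_eq_iff)
    have R: "others_cost M X N c L H i ?s' = ?R"
      by (subst s') (rule others_cost_upd)
    have cost: "social_cost M X N c L H (empirical_measure X N \<nu>) =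
        1 / of_nat N * player_cost M X N c L H i ?s + ?R"
      using social[OF fam] split[OF kernel[OF fam] i] by simp
    have cost': "social_cost M X N c L H (empirical_measure X N \<nu>') =
        1 / of_nat N * player_cost M X N c L H i ?s' + ?R"
      using social[OF fam'] split[OF kernel[OF fam'] i] R by simp
    have "empirical_measure X N \<nu>' \<in> random_measures M"
      by (rule empirical_measure_random_measure[where X=X, OF N X fam'])
    from opt[OF this] have "1 / of_nat N * player_cost M X N c L H i ?s + ?R
        \<le> 1 / of_nat N * player_cost M X N c L H i ?s' + ?R"
      unfolding cost cost' .
    \<comment> \<open>the minimal social cost is finite, so the common part can be cancelled\<close>
    moreover have "?R < \<infinity>"
      using fin unfolding cost by simp
    ultimately have "1 / of_nat N * player_cost M X N c L H i ?s
        \<le> 1 / of_nat N * player_cost M X N c L H i ?s'"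
      by (auto simp: add.commute[of _ ?R] ennreal_add_left_cancel_le)
    then have "player_cost M X N c L H i ?s \<le> player_cost M X N c L H i ?s'"
      using N by (simp add: divide_ennreal_def ennreal_mult_le_mult_iff)
    also have "\<dots> = player_cost M X N c L H i (?s(i := s'))"
      unfolding player_cost_def using \<eta>(2)
      by (intro nn_integral_cong) (auto simp: \<nu>'_def intro!: arg_cong2[where f="(+)"] sum.cong)
    finally show "player_cost M X N c L H i ?s \<le> player_cost M X N c L H i (?s(i := s'))" .
  qed
qed

end
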